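(* Let $2<p<q<r<s<t$ be primes such that $t\equiv \pm1\pmod{pqrs}$, $s\equiv\pm1\pmod{pqr}$, and $r\equiv\pm 1\pmod{pq}$. Then $A(pqrst)>1$.
   Context: $\Phi_n(x)$ denotes the $n$th cyclotomic polynomial. The height $A(n)$ is the maximum absolute value of the coefficients of $\Phi_n(x)$. The signs in the three congruences are independent. *)

theory Defs
  imports
    Complex_Main
    "HOL-Computational_Algebra.Polynomial"
    "HOL-Number_Theory.Cong"
    "HOL-Number_Theory.Totient"
begin

text \<open>
  The monic polynomial whose roots are the primitive \<open>n\<close>-th roots of unity, for \<open>n > 0\<close>. Its
  coefficients are integers, but it is taken over the complex numbers.
\<close>
definition cyclotomic_poly :: "nat \<Rightarrow> complex poly" where
  "cyclotomic_poly n = (\<Prod>k\<in>totatives n. [:- cis (2 * pi * real k / real n), 1:])"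

definition cyclotomic_height :: "nat \<Rightarrow> real" where
  "cyclotomic_height n =
     Max ((\<lambda>i. cmod (coeff (cyclotomic_poly n) i)) ` {..degree (cyclotomic_poly n)})"

end

(*
  Let Psi_n = (x^n - 1) / Phi_n. For a prime t not dividing n one has Phi_(n t) Phi_n = Phi_n(x^t),
  so that if t = +-1 mod n, then on suitable blocks of t consecutive indices the coefficients of
  Phi_(n t) are, up to sign, the values of a short cyclic convolution of an initial segment of
  Phi_n with Psi_n. Applying this to t over n = p q r s and, after complementing the convolution
  (Phi_n Psi_n = x^n - 1), to s over m = p q r, one finds among the coefficients of
  Phi_(p q r s t), up to sign, the sums (with K + v <= U + 1 and K, v, U small)
      sum over j < v and i <= K of  G_j G_i L_(U - i - j)
  where L = Phi_(p q) and G = (1 + ... + x^(p-1)) (1 - x^q) gives the coefficients of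
  Phi_(p q r) below p q; here L G = 1 - x^(p q). The choice K = q, v = q + p - 1, U = p q yields -2
  unless q = 1 mod p, in which case K = 1, v = 2, U = q yields 2.
*)

theory Submission
  imports Defs "HOL-Computational_Algebra.Fundamental_Theorem_Algebra"
begin

section \<open>Roots of unity and the identity Phi_(n s) Phi_n = Phi_n(x^s)\<close>

text \<open>The derivative s x^(s-1) vanishes at most at 0, which is not a root, so all roots are
  simple; they are \<open>w\<close> times the \<open>s\<close>-th roots of unity.\<close>

lemma monom_minus_const_eq_prod:
  fixes w :: complex
  assumes "s > 0" and "w \<noteq> 0"
  shows "monom 1 s - [:w ^ s:] = (\<Prod>j<s. [:- (w * cis (2 * pi * real j / real s)), 1:])"
proof -
  define P where "P = monom 1 s - [:w ^ s:]"
  have ev: "poly P z = z ^ s - w ^ s" for z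
    by (simp add: P_def poly_monom)
  have "poly (pderiv P) z = of_nat s * z ^ (s - 1)" for z
    by (simp add: P_def pderiv_diff pderiv_monom poly_monom pderiv_pCons)
  then have "rsquarefree P"
    using assms by (auto simp: rsquarefree_roots ev zero_power)
  moreover have "degree P = s"
    using assms degree_add_eq_left[of "- [:w ^ s:]" "monom 1 s"]
    by (simp add: P_def degree_monom_eq del: minus_pCons)
  then have "lead_coeff P = 1"
    using assms by (simp add: P_def coeff_pCons split: nat.split)
  ultimately have "P = (\<Prod>z | poly P z = 0. [:-z, 1:])"
    using complex_poly_decompose_rsquarefree[of P] by simp
  also have "{z. poly P z = 0} = (\<lambda>u. w * u) ` {u. u ^ s = 1}"
  proof -
    have "z \<in> (\<lambda>u. w * u) ` {u. u ^ s = 1}" if "z ^ s = w ^ s" for z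
      using that assms by (intro image_eqI[of _ _ "z / w"]) (auto simp: power_divide)
    then show ?thesis by (auto simp: ev power_mult_distrib)
  qed
  also have "(\<Prod>z\<in>(\<lambda>u. w * u) ` {u. u ^ s = 1}. [:-z, 1:]) = (\<Prod>u | u ^ s = 1. [:- (w * u), 1:])"
    using assms by (subst prod.reindex) (auto simp: inj_on_def)
  also have "\<dots> = (\<Prod>j<s. [:- (w * cis (2 * pi * real j / real s)), 1:])"
    using prod.reindex_bij_betw[OF bij_betw_roots_unity[OF assms(1)], of "\<lambda>u. [:- (w * u), 1:]"]
    by simp
  finally show ?thesis by (simp add: P_def)
qed

text \<open>Substituting x^s splits each linear factor of Phi_n over the \<open>s\<close>-th roots
  of a primitive \<open>n\<close>-th root. Together these are the cis (2 pi a / (n s)) with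
  \<open>a\<close> coprime to \<open>n\<close>: the \<open>a\<close> prime to \<open>s\<close> give
  Phi_(n s), the multiples of \<open>s\<close> give Phi_n again.\<close>

lemma cyclotomic_poly_pcompose_monom:
  assumes "n > 0" and "prime s" and "coprime s n"
  shows "cyclotomic_poly (n * s) * cyclotomic_poly n = pcompose (cyclotomic_poly n) (monom 1 s)"
proof -
  define F where "F = (\<lambda>a. [:- cis (2 * pi * real a / real (n * s)), 1:])"
  have s: "s > 0" using assms prime_gt_0_nat by blast
  define A where "A = {a. 0 < a \<and> a \<le> n * s \<and> coprime a n}"
  have *: "monom 1 s - [:cis (2 * pi * real k / real n):] = (\<Prod>j<s. F (k + n * j))" for k
  proof -
    define w where "w = cis (2 * pi * real k / real (n * s))"
    have "w ^ s = cis (2 * pi * real k / real n)"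
      unfolding w_def using s by (simp add: DeMoivre)
    moreover have "w * cis (2 * pi * real j / real s) = cis (2 * pi * real (k + n * j) / real (n * s))" for j
      unfolding w_def cis_mult using s assms(1) by (simp add: field_simps)
    moreover have "w \<noteq> 0" by (simp add: w_def)
    ultimately show ?thesis
      using monom_minus_const_eq_prod[OF s, of w] by (simp add: F_def)
  qed
  have "pcompose (cyclotomic_poly n) (monom 1 s) = (\<Prod>k\<in>totatives n. \<Prod>j<s. F (k + n * j))"
    unfolding cyclotomic_poly_def pcompose_prod
    by (intro prod.cong refl) (simp add: pcompose_pCons flip: *)
  also have "\<dots> = (\<Prod>(k, j)\<in>totatives n \<times> {..<s}. F (k + n * j))"
    by (rule prod.cartesian_product)
  \<comment> \<open>Totatives lie in 1..n and not in 0..n-1, so division with remainder is applied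
    to \<open>a - 1\<close>.\<close>
  also have "\<dots> = prod F A"
  proof (rule prod.reindex_bij_witness[where
      i = "\<lambda>a. ((a - 1) mod n + 1, (a - 1) div n)" and j = "\<lambda>(k, j). k + n * j"])
    fix x assume x: "x \<in> totatives n \<times> {..<s}"
    obtain k j where [simp]: "x = (k, j)" by force
    have "gcd (k + n * j) n = gcd k n"
      by (metis gcd_add_mult mult.commute add.commute gcd.commute)
    have k: "0 < k" "k \<le> n" "coprime k n" "j < s" using x by (auto simp: in_totatives_iff)
    have "k - 1 < n" using k by simp
    then have e: "k + n * j - 1 = (k - 1) + n * j" "(k - 1 + n * j) mod n = k - 1"
      "(k - 1 + n * j) div n = j"
      using k assms(1) by (simp, simp only: mod_mult_self2 mod_less, simp only: div_mult_self2 div_less)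
    show "(((case x of (k, j) \<Rightarrow> k + n * j) - 1) mod n + 1, ((case x of (k, j) \<Rightarrow> k + n * j) - 1) div n) = x"
      using k(1) by (simp only: \<open>x = (k, j)\<close> prod.case e) simp
    have "n * (j + 1) \<le> n * s" using k by (intro mult_le_mono) auto
    then show "(case x of (k, j) \<Rightarrow> k + n * j) \<in> A"
      using k \<open>gcd (k + n * j) n = gcd k n\<close> by (auto simp: A_def coprime_iff_gcd_eq_1)
  next
    fix a assume a: "a \<in> A"
    have e: "(a - 1) mod n + 1 + n * ((a - 1) div n) = a"
      using a mod_mult_div_eq[of "a - 1" n] by (simp add: A_def)
    then show "(case ((a - 1) mod n + 1, (a - 1) div n) of (k, j) \<Rightarrow> k + n * j) = a" by simp
    have "coprime ((a - 1) mod n + 1 + n * ((a - 1) div n)) n" using a e by (simp add: A_def)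
    then have "coprime ((a - 1) mod n + 1) n"
      by (metis coprime_iff_gcd_eq_1 gcd_add_mult mult.commute add.commute gcd.commute)
    moreover have "(a - 1) div n < s"
      using a by (intro less_mult_imp_div_less) (auto simp: A_def mult.commute)
    ultimately show "((a - 1) mod n + 1, (a - 1) div n) \<in> totatives n \<times> {..<s}"
      using assms(1) by (auto simp: in_totatives_iff Suc_le_eq)
  qed auto
  also have "A = totatives (n * s) \<union> (\<lambda>k. k * s) ` totatives n"
  proof (intro equalityI subsetI)
    fix a assume a: "a \<in> A"
    show "a \<in> totatives (n * s) \<union> (\<lambda>k. k * s) ` totatives n"
    proof (cases "s dvd a")
      case True
      then obtain k where "a = k * s" by (metis dvd_def mult.commute)
      then show ?thesis using a s by (auto simp: A_def in_totatives_iff)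
    next
      case False
      then have "coprime a s" using assms(2) by (metis coprime_commute prime_imp_coprime)
      then show ?thesis using a by (auto simp: A_def in_totatives_iff)
    qed
  next
    fix a assume "a \<in> totatives (n * s) \<union> (\<lambda>k. k * s) ` totatives n"
    then show "a \<in> A" using s assms(3) by (auto simp: A_def in_totatives_iff)
  qed
  also have "prod F (totatives (n * s) \<union> (\<lambda>k. k * s) ` totatives n)
      = prod F (totatives (n * s)) * prod F ((\<lambda>k. k * s) ` totatives n)"
  proof (rule prod.union_disjoint)
    show "totatives (n * s) \<inter> (\<lambda>k. k * s) ` totatives n = {}"
      using assms(2) by (auto simp: in_totatives_iff prime_nat_iff)
  qed auto
  also have "prod F ((\<lambda>k. k * s) ` totatives n) = (\<Prod>k\<in>totatives n. F (k * s))"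
    using s by (subst prod.reindex) (auto simp: inj_on_def)
  also have "\<dots> = cyclotomic_poly n"
    unfolding cyclotomic_poly_def F_def using s by (intro prod.cong) (auto simp: mult.assoc)
  finally show ?thesis by (simp add: cyclotomic_poly_def F_def)
qed

lemma cyclotomic_poly_1: "cyclotomic_poly 1 = [:-1, 1:]"
  by (simp add: cyclotomic_poly_def)

lemma monic_cyclotomic_poly: "lead_coeff (cyclotomic_poly n) = 1"
  by (simp add: cyclotomic_poly_def lead_coeff_prod)

lemma degree_cyclotomic_poly: "degree (cyclotomic_poly n) = totient n"
  by (simp add: cyclotomic_poly_def degree_prod_eq_sum_degree totient_def)

section \<open>Substitution of x^s: coefficients and palindromicity\<close>

lemma coeff_pcompose_monom:
  fixes f :: "'a::comm_semiring_1 poly"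
  assumes "s > 0"
  shows "coeff (pcompose f (monom 1 s)) k = (if s dvd k then coeff f (k div s) else 0)"
proof (induction f arbitrary: k)
  case (pCons a f)
  show ?case
  proof (cases "k < s")
    case True
    then show ?thesis
      by (cases "k = 0") (auto simp: pcompose_pCons coeff_monom_mult coeff_pCons dvd_imp_le split: nat.split)
  next
    case False
    then obtain j where k: "k = s + j" using le_Suc_ex not_less by blast
    show ?thesis
      using assms by (auto simp: pcompose_pCons coeff_monom_mult coeff_pCons pCons k split: nat.split)
  qed
qed simp

lemma pcompose_monom_minus_1:
  fixes s m :: nat
  assumes "s > 0"
  shows "pcompose (monom 1 m - 1) (monom 1 s) = (monom 1 (m * s) - 1 :: 'a::idom poly)"
proof (rule poly_eqI)
  fix k
  show "coeff (pcompose (monom 1 m - 1) (monom 1 s)) k = coeff (monom 1 (m * s) - 1 :: 'a poly) k"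
  proof (cases "s dvd k")
    case True
    then obtain j where "k = j * s" by (metis dvd_def mult.commute)
    then show ?thesis using assms by (simp add: coeff_pcompose_monom)
  next
    case False
    then have "k \<noteq> m * s" "k \<noteq> 0" by (auto intro: Nat.gr0I)
    then show ?thesis using False assms by (auto simp: coeff_pcompose_monom)
  qed
qed

lemma reflect_poly_pcompose_monom:
  fixes f :: "'a::idom poly"
  assumes "s > 0"
  shows "reflect_poly (pcompose f (monom 1 s)) = pcompose (reflect_poly f) (monom 1 s)"
proof (rule poly_eqI)
  fix k
  have d: "degree (pcompose f (monom 1 s)) = degree f * s"
    by (simp add: degree_pcompose degree_monom_eq)
  have "s dvd (degree f * s - k) \<longleftrightarrow> s dvd k" if "k \<le> degree f * s"
    using that by (metis dvd_diffD1 dvd_diff_nat dvd_triv_right)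
  moreover have "(degree f * s - j * s) div s = degree f - j" for j
    using assms by (simp flip: diff_mult_distrib)
  moreover have "degree f < j \<longleftrightarrow> degree f * s < j * s" for j
    using assms by simp
  ultimately show "coeff (reflect_poly (pcompose f (monom 1 s))) k = coeff (pcompose (reflect_poly f) (monom 1 s)) k"
    using assms by (auto simp: coeff_reflect_poly coeff_pcompose_monom d elim!: dvdE simp: mult.commute)
qed

text \<open>Reflection is multiplicative and commutes with x -> x^s, so \<open>c\<close> cancels.
  This carries palindromicity up the chain of cyclotomic polynomials; \<open>c\<close> allows for
  its start x - 1, whose reflection is its negative.\<close>

lemma reflect_poly_eq_of_pcompose_monom:
  fixes f h :: "'a::idom poly"
  assumes "h * f = pcompose f (monom 1 s)" and "s > 0" and "f \<noteq> 0"
    and "reflect_poly f = smult c f" and "c \<noteq> 0"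
  shows "reflect_poly h = h"
proof -
  have "reflect_poly h * smult c f = reflect_poly (h * f)"
    by (simp only: reflect_poly_mult assms(4))
  also have "\<dots> = h * smult c f"
    using assms by (simp add: reflect_poly_pcompose_monom pcompose_smult)
  finally show ?thesis
    using assms by (metis mult_right_cancel smult_eq_0_iff)
qed

section \<open>Periodic coefficients and the expansion of Phi_(n t)\<close>

lemma coeff_mult_monom:
  fixes g :: "'a::comm_semiring_1 poly"
  shows "coeff (g * monom 1 n) k = (if n \<le> k then coeff g (k - n) else 0)"
  using coeff_monom_mult[of 1 n g k] by (simp add: mult.commute not_less)

text \<open>The shifted copies of \<open>g\<close> do not overlap. The finite sum stands in for the
  power series 1 / (1 - x^n).\<close>

lemma coeff_mult_geometric_sum:
  fixes g :: "'a::comm_semiring_1 poly"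
  assumes "degree g < n" and "k < n * R"
  shows "coeff (g * (\<Sum>j<R. monom 1 (n * j))) k = coeff g (k mod n)"
proof -
  have n: "n > 0" using assms by simp
  have "coeff (g * (\<Sum>j<R. monom 1 (n * j))) k
      = (\<Sum>j<R. if n * j \<le> k then coeff g (k - n * j) else 0)"
    by (simp add: sum_distrib_left coeff_sum coeff_mult_monom)
  also have "\<dots> = (\<Sum>j<R. if j = k div n then coeff g (k mod n) else 0)"
  proof (rule sum.cong)
    fix j
    consider "j = k div n" | "j < k div n" | "k div n < j" by linarith
    then show "(if n * j \<le> k then coeff g (k - n * j) else 0) = (if j = k div n then coeff g (k mod n) else 0)"
    proof cases
      case 1
      then show ?thesis by (simp add: minus_mult_div_eq_mod)
    next
      case 2
      then have "n * (j + 1) \<le> n * (k div n)" by (intro mult_le_mono) auto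
      also have "\<dots> \<le> k" by simp
      finally have "n \<le> k - n * j" by simp
      then show ?thesis using assms 2 by (simp add: coeff_eq_0)
    next
      case 3
      then have "k < n * j" using n by (simp add: div_less_iff_less_mult mult.commute)
      then show ?thesis using 3 by simp
    qed
  qed simp
  also have "\<dots> = coeff g (k mod n)"
    using assms by (simp add: less_mult_imp_div_less mult.commute)
  finally show ?thesis .
qed

lemma geometric_sum_monom:
  fixes n R :: nat
  shows "(monom 1 n - 1) * (\<Sum>j<R. monom 1 (n * j)) = (monom 1 (n * R) - 1 :: 'a::comm_ring_1 poly)"
proof (induction R)
  case (Suc R)
  then show ?case by (simp add: algebra_simps mult_monom)
qed simp

text \<open>As power series f g / (1 - x^n) = -1, so every coefficient of positive index vanishes;
  from index \<open>degree f\<close> on, the convolution involves all of \<open>f\<close>.\<close>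

lemma sum_coeff_periodic_eq_0:
  fixes f g :: "'a::comm_ring_1 poly"
  assumes "f * g = monom 1 n - 1" and "degree g < n" and "degree f \<le> e" and "0 < e"
  shows "(\<Sum>i\<le>degree f. coeff f i * coeff g ((e - i) mod n)) = 0"
proof -
  define G where "G = g * (\<Sum>j<Suc e. monom 1 (n * j))"
  have n: "n > 0" using assms by simp
  then have eR: "e < n * Suc e" by (cases n) auto
  have "f * G = monom 1 (n * Suc e) - 1"
    unfolding G_def using assms(1) geometric_sum_monom[of n "Suc e"] by (metis mult.assoc)
  then have "coeff (f * G) e = 0"
    using eR assms(4) by simp
  then have "0 = (\<Sum>i\<le>e. coeff f i * coeff G (e - i))"
    by (simp add: coeff_mult)
  also have "\<dots> = (\<Sum>i\<le>degree f. coeff f i * coeff G (e - i))"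
    using assms(3) by (intro sum.mono_neutral_right) (auto simp: coeff_eq_0)
  also have "\<dots> = (\<Sum>i\<le>degree f. coeff f i * coeff g ((e - i) mod n))"
    unfolding G_def using eR assms(2)
    by (intro sum.cong refl) (subst coeff_mult_geometric_sum, auto)
  finally show ?thesis by simp
qed

text \<open>As power series, \<open>h = - f(x^t) g (1 + x^n + x^(2n) + \<dots>)\<close>.\<close>

lemma coeff_kaplan:
  fixes f g h :: "'a::idom poly"
  assumes "f * g = monom 1 n - 1" and "degree g < n" and "h * f = pcompose f (monom 1 t)"
    and "f \<noteq> 0" and "t > 0"
  shows "coeff h k = - (\<Sum>i\<le>k div t. coeff f i * coeff g ((k - t * i) mod n))"
proof -
  define G where "G = g * (\<Sum>j<Suc k. monom 1 (n * j))"
  have n: "n > 0" using assms by simp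
  then have kR: "k < n * Suc k" by (cases n) auto
  have fG: "f * G = monom 1 (n * Suc k) - 1"
    unfolding G_def using assms(1) geometric_sum_monom[of n "Suc k"] by (metis mult.assoc)
  \<comment> \<open>Up to index \<open>k\<close>, multiplication by x^(n (k+1)) - 1 is just a change
    of sign.\<close>
  have "h * (monom 1 (n * Suc k) - 1) = pcompose f (monom 1 t) * G"
    unfolding assms(3)[symmetric] fG[symmetric] by (simp only: mult.assoc)
  then have "coeff (h * monom 1 (n * Suc k)) k - coeff h k = coeff (pcompose f (monom 1 t) * G) k"
    by (simp add: right_diff_distrib flip: coeff_diff)
  then have "- coeff h k = coeff (pcompose f (monom 1 t) * G) k"
    using kR by (simp add: coeff_mult_monom del: mult_Suc_right)
  also have "\<dots> = (\<Sum>j\<le>k. (if t dvd j then coeff f (j div t) else 0) * coeff G (k - j))"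
    using assms(5) by (simp add: coeff_mult coeff_pcompose_monom)
  also have "\<dots> = (\<Sum>j\<in>(\<lambda>i. t * i) ` {..k div t}. (if t dvd j then coeff f (j div t) else 0) * coeff G (k - j))"
  proof (rule sum.mono_neutral_right)
    show "(*) t ` {..k div t} \<subseteq> {..k}"
      by (auto simp: assms(5) less_eq_div_iff_mult_less_eq mult.commute)
    show "\<forall>i\<in>{..k} - (*) t ` {..k div t}. (if t dvd i then coeff f (i div t) else 0) * coeff G (k - i) = 0"
      by (auto simp: assms(5) less_eq_div_iff_mult_less_eq mult.commute elim!: dvdE)
  qed simp
  also have "\<dots> = (\<Sum>i\<le>k div t. coeff f i * coeff G (k - t * i))"
    using assms(5) by (subst sum.reindex) (auto simp: inj_on_def)
  also have "\<dots> = (\<Sum>i\<le>k div t. coeff f i * coeff g ((k - t * i) mod n))"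
    unfolding G_def using kR assms(2)
    by (intro sum.cong refl) (subst coeff_mult_geometric_sum, auto)
  finally show ?thesis by (metis minus_minus)
qed

lemma mod_eq_of_cong_int:
  fixes a b n :: nat
  assumes "[int a = int b] (mod int n)"
  shows "a mod n = b mod n"
  using assms unfolding cong_int_iff by (simp add: cong_def)

text \<open>
  Modulo \<open>n\<close> the shifts \<open>t i\<close> become \<open>\<plusminus>i\<close>, so on a whole block of length \<open>t\<close> only the first \<open>K + 1\<close>
  coefficients of \<open>f\<close> matter; for the sign \<open>-\<close> the block is one near the top, by palindromicity.
\<close>

lemma coeff_block:
  fixes f g h :: "'a::idom poly"
  assumes fg: "f * g = monom 1 n - 1" and g: "degree g < n" and h: "h * f = pcompose f (monom 1 t)"
    and f: "f \<noteq> 0" "reflect_poly f = f" and t: "t > 0"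
    and cong: "[int t = 1] (mod int n) \<or> [int t = - 1] (mod int n)"
    and K: "K < degree f"
  shows "\<exists>Q \<epsilon> \<delta>. Q \<in> {K, degree f - 1 - K} \<and> \<epsilon> \<in> {1, -1} \<and> K \<le> \<delta> \<and>
    (\<forall>k. k div t = Q \<longrightarrow> coeff h k = \<epsilon> * (\<Sum>i\<le>K. coeff f i * coeff g ((k + \<delta> - i) mod n)))"
  using cong
proof
  assume t1: "[int t = 1] (mod int n)"
  \<comment> \<open>The shift \<open>\<delta>\<close> = n K is 0 modulo \<open>n\<close> and keeps
    the subtraction of \<open>i\<close> from truncating.\<close>
  have "K \<le> n * K" using g by simp
  have "coeff h k = -1 * (\<Sum>i\<le>K. coeff f i * coeff g ((k + n * K - i) mod n))" if k: "k div t = K" for k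
  proof -
    have "(k - t * i) mod n = (k + n * K - i) mod n" if "i \<le> K" for i
    proof (rule mod_eq_of_cong_int)
      have "t * i \<le> k"
        using that k t by (metis less_eq_div_iff_mult_less_eq mult.commute)
      moreover have "i \<le> k + n * K"
        using that \<open>K \<le> n * K\<close> by linarith
      moreover have "[int k - int t * int i + 0 = int k - 1 * int i + int n * int K] (mod int n)"
        using t1 by (intro cong_add cong_diff cong_mult) (auto simp: cong_def)
      ultimately show "[int (k - t * i) = int (k + n * K - i)] (mod int n)"
        by (simp add: of_nat_diff algebra_simps)
    qed
    then show ?thesis
      using coeff_kaplan[OF fg g h f(1) t, of k] k by simp
  qed
  moreover note \<open>K \<le> n * K\<close>
  ultimately show ?thesis by blast
next
  assume t1: "[int t = - 1] (mod int n)"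
  have n: "n > 0" using g by simp
  define d where "d = degree f"
  have refl: "coeff f (d - i) = coeff f i" if "i \<le> d" for i
    using that f(2) unfolding d_def by (metis coeff_reflect_poly not_le)
  have "coeff h k = 1 * (\<Sum>i\<le>K. coeff f i * coeff g ((k + d - i) mod n))" if k: "k div t = d - 1 - K" for k
  proof -
    have "(k - t * i) mod n = (k + i) mod n" if "i \<le> d - 1 - K" for i
    proof (rule mod_eq_of_cong_int)
      have "t * i \<le> k"
        using that k t by (metis less_eq_div_iff_mult_less_eq mult.commute)
      moreover have "[int k - int t * int i = int k - (-1) * int i] (mod int n)"
        using t1 by (intro cong_diff cong_mult) auto
      ultimately show "[int (k - t * i) = int (k + i)] (mod int n)"
        by (simp add: of_nat_diff algebra_simps)
    qed
    then have 1: "coeff h k = - (\<Sum>i\<le>d - 1 - K. coeff f i * coeff g ((k + i) mod n))"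
      using coeff_kaplan[OF fg g h f(1) t, of k] k by simp
    \<comment> \<open>Palindromicity allows i -> d - i, which turns the initial sum into the tail K
      < i \<le> d of the full sum with shift \<open>d\<close>.\<close>
    have 2: "(\<Sum>i\<le>d - 1 - K. coeff f i * coeff g ((k + i) mod n))
        = (\<Sum>i\<in>{K<..d}. coeff f i * coeff g ((k + d - i) mod n))"
      using K by (intro sum.reindex_bij_witness[of _ "\<lambda>i. d - i" "\<lambda>i. d - i"]) (use refl in \<open>auto simp: d_def\<close>)
    \<comment> \<open>The full periodic sum is 0, so the tail is minus the part i \<le> K.\<close>
    have "0 = (\<Sum>i\<le>d. coeff f i * coeff g ((k + d - i) mod n))"
      using sum_coeff_periodic_eq_0[OF fg g, of "k + d"] K by (simp add: d_def)
    also have "{..d} = {..K} \<union> {K<..d}" using K by (auto simp: d_def)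
    also have "(\<Sum>i\<in>\<dots>. coeff f i * coeff g ((k + d - i) mod n))
      = (\<Sum>i\<le>K. coeff f i * coeff g ((k + d - i) mod n))
        + (\<Sum>i\<in>{K<..d}. coeff f i * coeff g ((k + d - i) mod n))"
      by (rule sum.union_disjoint) auto
    finally show ?thesis unfolding 1 2 by (simp add: neg_eq_iff_add_eq_0 add.commute)
  qed
  moreover have "K \<le> d" using K by (simp add: d_def)
  ultimately show ?thesis unfolding d_def by blast
qed

section \<open>The block formula applied twice\<close>

lemma degree_cofactor_less:
  fixes f g :: "'a::idom poly"
  assumes "f * g = monom 1 n - 1" and "n > 0" and "degree f > 0"
  shows "degree g < n"
proof (cases "g = 0")
  case False
  have "degree f + degree g = degree (monom 1 n - 1 :: 'a poly)"
    unfolding assms(1)[symmetric] using False assms(3) by (subst degree_mult_eq) auto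
  also have "\<dots> \<le> n" by (intro degree_diff_le degree_monom_le) auto
  finally show ?thesis using assms by simp
qed (use assms in simp)

text \<open>Serves to find, inside a block, an index with a prescribed residue.\<close>

lemma ex_mod_eq:
  fixes m w c U :: nat
  assumes "m > 0"
  shows "\<exists>e. w \<le> e \<and> e < w + m \<and> (e + c) mod m = U mod m"
proof -
  define x where "x = nat ((int U - int w - int c) mod int m)"
  have x: "int x = (int U - int w - int c) mod int m" using assms by (simp add: x_def)
  have "int ((w + x + c) mod m) = ((int U - int w - int c) mod int m + (int w + int c)) mod int m"
    by (simp add: zmod_int x algebra_simps)
  also have "\<dots> = int (U mod m)"
    by (simp add: mod_add_left_eq zmod_int)
  finally have "int ((w + x + c) mod m) = int (U mod m)" .
  moreover have "x < m" using x assms by (metis of_nat_0_less_iff of_nat_less_iff pos_mod_bound)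
  ultimately show ?thesis by (intro exI[of _ "w + x"]) simp
qed

lemma diff_mod_eq:
  fixes x U c m :: nat
  assumes "x mod m = U" and "c \<le> U" and "U < m"
  shows "(x - c) mod m = U - c"
proof -
  have "x = U + m * (x div m)" using assms(1) by (metis mod_mult_div_eq)
  then have "x - c = (U - c) + m * (x div m)" using assms(2) by linarith
  then show ?thesis using assms(3) by simp
qed

text \<open>This is Psi_(m s) = Phi_m Psi_m(x^s), since Phi_(m s) Phi_m Psi_m(x^s) = (Phi_m
  Psi_m)(x^s). Below degree \<open>s\<close> only the constant term of Psi_m(x^s)
  contributes.\<close>

lemma ex_cofactor_pcompose_monom:
  fixes f g a :: "'a::idom poly"
  assumes "f * g = monom 1 m - 1" and "a * f = pcompose f (monom 1 s)" and s: "s > 0"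
  shows "\<exists>b. b = f * pcompose g (monom 1 s) \<and> a * b = monom 1 (m * s) - 1 \<and>
    (\<forall>j<s. coeff b j = coeff g 0 * coeff f j)"
proof -
  define b where "b = f * pcompose g (monom 1 s)"
  have "a * b = pcompose (f * g) (monom 1 s)"
    by (simp add: b_def assms(2) pcompose_mult flip: mult.assoc)
  also have "\<dots> = monom 1 (m * s) - 1"
    by (simp only: assms(1) pcompose_monom_minus_1[OF s])
  finally have ab: "a * b = monom 1 (m * s) - 1" .
  have coeff_b: "coeff b j = coeff g 0 * coeff f j" if "j < s" for j
  proof -
    have "coeff b j = (\<Sum>i\<le>j. coeff f i * (if s dvd j - i then coeff g ((j - i) div s) else 0))"
      using s by (simp add: b_def coeff_mult coeff_pcompose_monom)
    also have "\<dots> = (\<Sum>i\<le>j. if i = j then coeff g 0 * coeff f i else 0)"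
    proof (intro sum.cong refl)
      fix i assume "i \<in> {..j}"
      moreover have "\<not> s dvd j - i" if "i < j"
        using that \<open>j < s\<close> by (auto dest: dvd_imp_le)
      ultimately show "coeff f i * (if s dvd j - i then coeff g ((j - i) div s) else 0)
          = (if i = j then coeff g 0 * coeff f i else 0)"
        by (auto simp: mult.commute)
    qed
    finally show ?thesis by simp
  qed
  show ?thesis using ab coeff_b b_def by blast
qed

text \<open>The roles are f = Phi_m, g = Psi_m, a = Phi_(m s), h = Phi_(m s t), and \<open>b\<close>
  in the proof is Psi_(m s). One block formula expresses \<open>h\<close> by \<open>a\<close> and
  \<open>b\<close>, the other \<open>a\<close> by \<open>f\<close> and \<open>g\<close>.\<close>

lemma coeff_two_blocks:
  fixes f g a h :: "'a::idom poly"
  assumes fg: "f * g = monom 1 m - 1" and f: "reflect_poly f = f" and g0: "coeff g 0 = -1"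
    and a: "a * f = pcompose f (monom 1 s)" "reflect_poly a = a"
    and h: "h * a = pcompose a (monom 1 t)"
    and s: "[int s = 1] (mod int m) \<or> [int s = - 1] (mod int m)" "2 * m \<le> s + 1"
    and t: "[int t = 1] (mod int (m * s)) \<or> [int t = - 1] (mod int (m * s))" "m * s \<le> t"
    and K: "0 < K" "K + 2 \<le> degree f" and v: "0 < v" "K + v \<le> U + 1" and U: "U < m"
  shows "\<exists>k. \<exists>\<epsilon>\<in>{1, -1}. coeff h k =
    \<epsilon> * (\<Sum>j<v. \<Sum>i\<le>K. coeff f j * coeff f i * coeff g (U - (i + j)))"
proof -
  define d where "d = degree f"
  have d: "d \<ge> 3" "f \<noteq> 0" using K by (auto simp: d_def)
  have m: "m > 0" using U by simp
  have vm: "v < m" using v K U by simp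
  have g: "degree g < m" using degree_cofactor_less[OF fg m] d by (simp add: d_def)
  have g_nz: "g \<noteq> 0" using g0 by auto
  have dm: "d < m + 1"
  proof -
    have "d \<le> degree (f * g)" using d g_nz by (simp add: degree_mult_eq d_def)
    also have "\<dots> \<le> m" unfolding fg by (intro degree_diff_le degree_monom_le) auto
    finally show ?thesis by simp
  qed
  have s_pos: "s > 0" using s m by simp
  have ds: "d \<le> s" using s dm m by simp
  have "a * f \<noteq> 0" unfolding a(1) using d s_pos by (simp add: pcompose_eq_0_iff degree_monom_eq)
  then have a_nz: "a \<noteq> 0" by auto
  obtain b where b_def: "b = f * pcompose g (monom 1 s)" and ab: "a * b = monom 1 (m * s) - 1"
    and coeff_b: "\<And>j. j < s \<Longrightarrow> coeff b j = - coeff f j"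
    using ex_cofactor_pcompose_monom[OF fg a(1) s_pos] g0 by auto
  have deg_a: "degree a + d = d * s"
    using arg_cong[OF a(1), of degree] a_nz d s_pos
    by (simp add: degree_mult_eq degree_pcompose degree_monom_eq d_def)
  have "d * 2 \<le> d * s" using d ds by (intro mult_le_mono) auto
  then have "degree a > 0" using deg_a d by linarith
  then have b: "degree b < m * s" using degree_cofactor_less[OF ab] m s_pos by simp
  obtain Q \<epsilon> \<delta> where Q: "Q \<in> {K, d - 1 - K}" and \<epsilon>: "\<epsilon> \<in> {1, -1}" and \<delta>: "K \<le> \<delta>"
    and block: "\<And>k. k div s = Q \<Longrightarrow>
      coeff a k = \<epsilon> * (\<Sum>i\<le>K. coeff f i * coeff g ((k + \<delta> - i) mod m))"
    using coeff_block[OF fg g a(1) d(2) f s_pos s(1), of K] K unfolding d_def by auto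
  \<comment> \<open>Since v < m and 2 m \<le> s + 1, block \<open>Q\<close> has room for
    \<open>v\<close> indices and a full period; hence all \<open>e - j\<close> with j < v stay in
    it.\<close>
  obtain e where e: "Q * s + v \<le> e" "e < Q * s + v + m" "(e + \<delta>) mod m = U mod m"
    using ex_mod_eq[OF m] by blast
  have e_less: "e < (Q + 1) * s" using e(2) vm s(2) by simp
  \<comment> \<open>The cut leaves exactly the \<open>v\<close> indices \<open>e - j\<close>, j < v,
    above \<open>M\<close>.\<close>
  define M where "M = e - v"
  have coeff_a: "coeff a (e - j) = \<epsilon> * (\<Sum>i\<le>K. coeff f i * coeff g (U - (i + j)))" if j: "j < v" for j
  proof -
    have "(e - j) div s = Q"
      using j e(1) e_less by (intro div_nat_eqI) (auto simp: mult.commute)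
    moreover have "(e - j + \<delta> - i) mod m = U - (i + j)" if "i \<le> K" for i
    proof -
      have "e - j + \<delta> - i = e + \<delta> - (i + j)" using j e(1) by simp
      then show ?thesis
        using diff_mod_eq[of "e + \<delta>" m U "i + j"] e(3) U that j v by simp
    qed
    ultimately show ?thesis by (simp add: block)
  qed
  \<comment> \<open>Both candidates for \<open>Q\<close> satisfy Q + 1 \<le> d - 1, by 0 < K and K +
    2 \<le> d; the block thus lies below deg a = d s - d.\<close>
  have "(Q + 1) * s \<le> (d - 1) * s" using Q K by (intro mult_le_mono) (auto simp: d_def)
  also have "\<dots> = d * s - s" by (simp add: diff_mult_distrib)
  also have "\<dots> \<le> degree a" using deg_a ds by simp
  finally have Qs: "(Q + 1) * s \<le> degree a" .
  then have M: "M < degree a" and e_deg: "e < degree a" using e_less by (auto simp: M_def)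
  have "degree a \<le> degree (a * b)" using a_nz g_nz d s_pos
    by (subst degree_mult_eq) (auto simp: b_def pcompose_eq_0_iff degree_monom_eq)
  also have "\<dots> \<le> m * s" unfolding ab by (intro degree_diff_le degree_monom_le) auto
  finally have e_lt: "e < m * s" using e_deg by simp
  have t_pos: "t > 0" using t(2) m s_pos by (metis gr_zeroI leD nat_0_less_mult_iff)
  obtain Q' \<epsilon>' \<delta>' where \<epsilon>': "\<epsilon>' \<in> {1, -1}" and \<delta>': "M \<le> \<delta>'"
    and block': "\<And>k. k div t = Q' \<Longrightarrow>
      coeff h k = \<epsilon>' * (\<Sum>i\<le>M. coeff a i * coeff b ((k + \<delta>' - i) mod (m * s)))"
    using coeff_block[OF ab b h a_nz a(2) t_pos t(1) M] by auto
  \<comment> \<open>A block of length \<open>t\<close> contains a full period \<open>m * s\<close>,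
    so the arguments of \<open>b\<close> can be made exactly \<open>e - i\<close>.\<close>
  obtain k where k: "Q' * t \<le> k" "k < Q' * t + m * s" "(k + \<delta>') mod (m * s) = e mod (m * s)"
    using ex_mod_eq[of "m * s"] m s_pos by (metis nat_0_less_mult_iff)
  have "k div t = Q'"
    using k t(2) by (intro div_nat_eqI) (auto simp: mult.commute)
  moreover have "(k + \<delta>' - i) mod (m * s) = e - i" if "i \<le> M" for i
    using diff_mod_eq[of "k + \<delta>'" "m * s" e i] k(3) e_lt that by (simp add: M_def)
  ultimately have h_k: "coeff h k = \<epsilon>' * (\<Sum>i\<le>M. coeff a i * coeff b (e - i))"
    by (simp add: block')
  \<comment> \<open>The low part of the convolution \<open>a b\<close> at \<open>e\<close> is traded for the high part, which involves
    only \<open>v\<close> coefficients of \<open>a\<close>, all in the block \<open>Q\<close>.\<close>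
  have "0 = coeff (a * b) e" using e(1) v(1) e_lt by (simp add: ab)
  also have "\<dots> = (\<Sum>i\<in>{..M} \<union> {M<..e}. coeff a i * coeff b (e - i))"
    unfolding coeff_mult by (rule sum.cong) (auto simp: M_def)
  also have "\<dots> = (\<Sum>i\<le>M. coeff a i * coeff b (e - i)) + (\<Sum>i\<in>{M<..e}. coeff a i * coeff b (e - i))"
    by (rule sum.union_disjoint) auto
  also have "(\<Sum>i\<in>{M<..e}. coeff a i * coeff b (e - i)) = (\<Sum>j<v. coeff a (e - j) * coeff b j)"
    using e(1) by (intro sum.reindex_bij_witness[of _ "\<lambda>i. e - i" "\<lambda>i. e - i"]) (auto simp: M_def)
  \<comment> \<open>Here j < v < m \<le> s, the range where \<open>b\<close> agrees with
    \<open>- f\<close>.\<close>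
  also have "\<dots> = - (\<Sum>j<v. coeff f j * coeff a (e - j))"
    unfolding sum_negf[symmetric] using vm s(2) m by (intro sum.cong) (auto simp: coeff_b)
  finally have "coeff h k = \<epsilon>' * (\<Sum>j<v. coeff f j * coeff a (e - j))"
    by (simp add: h_k)
  also have "\<dots> = (\<epsilon>' * \<epsilon>) * (\<Sum>j<v. \<Sum>i\<le>K. coeff f j * coeff f i * coeff g (U - (i + j)))"
    by (simp add: coeff_a sum_distrib_left mult_ac)
  finally show ?thesis using \<epsilon> \<epsilon>' by (intro exI[of _ k] bexI[of _ "\<epsilon>' * \<epsilon>"]) auto
qed

section \<open>The polynomial Phi_(p q) and the two double sums\<close>

text \<open>The quotient (x^p - 1) / (x - 1), which is Phi_p for prime \<open>p\<close>.\<close>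

definition ones :: "nat \<Rightarrow> 'a::comm_ring_1 poly" where
  "ones p = (\<Sum>i<p. monom 1 i)"

lemma coeff_ones: "coeff (ones p) k = (if k < p then 1 else 0)"
  by (simp add: ones_def coeff_sum)

lemma ones_mult: "ones p * (monom 1 1 - 1) = monom 1 p - 1"
  using geometric_sum_monom[of 1 p] by (simp add: ones_def mult.commute)

text \<open>Multiplying by x - 1 gives L (x^p - 1) = W (x - 1) with W = 1 + x^q + ... + x^((p-1) q),
  a recurrence of step \<open>p\<close> for the coefficients of \<open>L\<close>. Below
  \<open>q\<close> only the constant term of \<open>W\<close> acts; at \<open>q\<close> its next
  term adds 1.\<close>

lemma coeff_binary_cyclotomic:
  fixes L :: "'a::idom poly"
  assumes L: "L * ones p = pcompose (ones p) (monom 1 q)" and p: "1 < p" "p < q"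
  shows "k < q \<Longrightarrow> coeff L k = of_bool (k mod p = 0) - of_bool (k mod p = 1)"
    and "coeff L q = of_bool (q mod p = 0) - of_bool (q mod p = 1) + 1"
proof -
  define W :: "'a poly" where "W = pcompose (ones p) (monom 1 q)"
  have q: "q > 0" using p by simp
  have W: "coeff W k = (if q dvd k then if k div q < p then 1 else 0 else 0)" for k
    by (simp only: W_def coeff_pcompose_monom[OF q] coeff_ones)
  have "L * (monom 1 p - 1) = W * (monom 1 1 - 1)"
    unfolding W_def L[symmetric] by (simp only: ones_mult mult.assoc)
  then have "coeff (L * monom 1 p) k - coeff L k = coeff (W * monom 1 1) k - coeff W k" for k
    by (simp add: right_diff_distrib flip: coeff_diff)
  then have rec: "coeff L k = (if p \<le> k then coeff L (k - p) else 0) + coeff W k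
      - (if 1 \<le> k then coeff W (k - 1) else 0)" for k
    unfolding coeff_mult_monom by (simp add: algebra_simps)
  have below: "coeff L k = of_bool (k mod p = 0) - of_bool (k mod p = 1)" if "k < q" for k
    using that
  proof (induction k rule: less_induct)
    case (less k)
    consider "k = 0" | "k = 1" | "1 < k" "k < p" | "p \<le> k" by linarith
    then show ?case
    proof cases
      case 4
      then have "\<not> q dvd k" "\<not> q dvd k - 1"
        using less.prems p by (auto dest!: dvd_imp_le)
      then have "coeff L k = coeff L (k - p)" using 4 p by (subst rec) (simp add: W)
      also have "\<dots> = of_bool ((k - p) mod p = 0) - of_bool ((k - p) mod p = 1)"
        using 4 p less.prems by (intro less.IH) auto
      also have "(k - p) mod p = k mod p" using 4 by (simp add: le_mod_geq)
      finally show ?thesis .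
    next
      case 3
      then have "\<not> q dvd k" "\<not> q dvd k - 1"
        using less.prems by (auto dest!: dvd_imp_le)
      then show ?thesis using 3 p by (subst rec) (simp add: W)
    qed (use p in \<open>subst rec; simp add: W\<close>)+
  qed
  then show "k < q \<Longrightarrow> coeff L k = of_bool (k mod p = 0) - of_bool (k mod p = 1)" .
  have "\<not> q dvd q - 1" using p by (auto dest!: dvd_imp_le)
  then have "coeff L q = coeff L (q - p) + 1" using p by (subst rec) (simp add: W)
  moreover have "(q - p) mod p = q mod p" using p by (simp add: le_mod_geq)
  ultimately show "coeff L q = of_bool (q mod p = 0) - of_bool (q mod p = 1) + 1"
    using below[of "q - p"] p by simp
qed

text \<open>Lets the double sums be computed as one coefficient of a product. The bound on K + v
  ensures i + j \<le> U, so no difference truncates.\<close>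

lemma coeff_monom_sums_mult:
  fixes L :: "'a::comm_semiring_1 poly"
  assumes "K + v \<le> U + 1" and "0 < v"
  shows "coeff ((\<Sum>j<v. monom (b j) j) * (\<Sum>i\<le>K. monom (c i) i) * L) U
    = (\<Sum>j<v. \<Sum>i\<le>K. b j * c i * coeff L (U - (i + j)))"
proof -
  have "(\<Sum>j<v. monom (b j) j) * (\<Sum>i\<le>K. monom (c i) i) * L
      = (\<Sum>j<v. \<Sum>i\<le>K. monom (b j * c i) (j + i) * L)"
    by (simp only: sum_product) (simp only: sum_distrib_right mult_monom)
  then have "coeff ((\<Sum>j<v. monom (b j) j) * (\<Sum>i\<le>K. monom (c i) i) * L) U
      = (\<Sum>j<v. \<Sum>i\<le>K. coeff (monom (b j * c i) (j + i) * L) U)"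
    by (simp add: coeff_sum)
  also have "\<dots> = (\<Sum>j<v. \<Sum>i\<le>K. b j * c i * coeff L (U - (i + j)))"
    using assms by (intro sum.cong refl) (auto simp: coeff_monom_mult add.commute)
  finally show ?thesis .
qed

lemma coeff_ones_mult_one_minus_monom:
  assumes "p < q"
  shows "coeff (ones p * (1 - monom 1 q)) i = (if i < p then 1 else if q \<le> i \<and> i < q + p then -1 else 0)"
  using assms by (simp add: right_diff_distrib coeff_mult_monom coeff_ones) auto

text \<open>Identifies Psi_(p q): the factor x^q - 1 completes Phi_p(x^q) to x^(p q) - 1.\<close>

lemma binary_cyclotomic_cofactor:
  fixes L :: "'a::idom poly"
  assumes L: "L * ones p = pcompose (ones p) (monom 1 q)" and q: "q > 0"
  shows "L * (ones p * (monom 1 q - 1)) = monom 1 (p * q) - 1"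
proof -
  have "L * (ones p * (monom 1 q - 1)) = pcompose (ones p) (monom 1 q) * (monom 1 q - 1)"
    unfolding L[symmetric] by (simp only: mult.assoc)
  also have "\<dots> = pcompose (ones p * (monom 1 1 - 1)) (monom 1 q)"
    using q by (simp add: pcompose_mult pcompose_monom_minus_1)
  also have "\<dots> = monom 1 (p * q) - 1"
    unfolding ones_mult using q by (simp add: pcompose_monom_minus_1)
  finally show ?thesis .
qed

text \<open>One -1 comes from the constant term of \<open>A\<close> moved to x^(p q), the other from
  L_q = 1, which enters through the monomial correcting \<open>B\<close>.\<close>

lemma double_sum_binary_cyclotomic:
  fixes L :: "'a::idom poly"
  assumes L: "L * ones p = pcompose (ones p) (monom 1 q)" and p: "2 < p" "p < q" and np: "\<not> p dvd q"
    and d: "degree L = (p - 1) * (q - 1)" and refl: "reflect_poly L = L"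
    and q: "q mod p \<noteq> 1"
  defines "G \<equiv> coeff (ones p * (1 - monom 1 q))"
  shows "(\<Sum>j<q + p - 1. \<Sum>i\<le>q. G j * G i * coeff L (p * q - (i + j))) = -2"
proof -
  define E :: "'a poly" where "E = ones p"
  \<comment> \<open>\<open>A\<close> and \<open>B\<close> are truncations of \<open>E (1 - x^q)\<close> (coefficients \<open>G\<close>), the inverse of \<open>L\<close> modulo \<open>x^(p q)\<close>.\<close>
  define A where "A = E - monom 1 q"
  define B where "B = E * (1 - monom 1 q) + monom 1 (q + p - 1)"
  have G: "G i = (if i < p then 1 else if q \<le> i \<and> i < q + p then -1 else 0)" for i
    unfolding G_def using p by (simp add: coeff_ones_mult_one_minus_monom)
  have A: "(\<Sum>i\<le>q. monom (G i) i) = A"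
    using p by (intro poly_eqI) (simp add: coeff_sum A_def E_def coeff_ones G)
  have B: "(\<Sum>j<q + p - 1. monom (G j) j) = B"
  proof (rule poly_eqI)
    fix i
    have "coeff B i = G i + (if i = q + p - 1 then 1 else 0)"
      by (simp add: B_def E_def flip: G_def)
    then show "coeff (\<Sum>j<q + p - 1. monom (G j) j) i = coeff B i"
      using p by (simp add: coeff_sum G) auto
  qed
  have pq: "3 * q \<le> p * q" using p by (intro mult_le_mono) auto
  have ELq: "L * E * (1 - monom 1 q) = 1 - monom 1 (p * q)"
    using binary_cyclotomic_cofactor[OF L] p by (simp add: E_def algebra_simps)
  have "B * A * L = A * (L * E * (1 - monom 1 q)) + A * L * monom 1 (q + p - 1)"
    by (simp add: B_def algebra_simps)
  also have "\<dots> = A * (1 - monom 1 (p * q)) + (L * E - L * monom 1 q) * monom 1 (q + p - 1)"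
    unfolding ELq by (simp add: A_def algebra_simps)
  finally have BAL: "B * A * L = A - A * monom 1 (p * q) + (L * E - L * monom 1 q) * monom 1 (q + p - 1)"
    by (simp add: algebra_simps)
  \<comment> \<open>D = deg L is also p q - (q + p - 1), the index left after removing the shift, so
    palindromicity turns L_(D-q) into L_q.\<close>
  define D where "D = (p - 1) * (q - 1)"
  have D: "D + (q + p - 1) = p * q" using p by (cases p; cases q) (auto simp: D_def)
  have "2 * (q - 1) \<le> D" using p unfolding D_def by (intro mult_le_mono) auto
  then have Dq: "q \<le> D" using p by linarith
  \<comment> \<open>\<open>L * E\<close> is a polynomial in x^q, so its coefficient at
    \<open>D\<close> is 0.\<close>
  have "\<not> q dvd D"
  proof
    assume "q dvd D"
    then have "q dvd D + (q + p - 1) - D - q" unfolding D by simp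
    then have "q dvd p - 1" using p by simp
    then show False using p by (auto dest: dvd_imp_le)
  qed
  then have LE: "coeff (L * E) D = 0" using p by (simp add: E_def L coeff_pcompose_monom)
  have "coeff L (D - q) = coeff L q"
    using refl Dq unfolding D_def d[symmetric] by (metis coeff_reflect_poly not_le)
  also have "\<dots> = 1"
    using coeff_binary_cyclotomic(2)[OF L] p q np by (simp add: dvd_eq_mod_eq_0)
  finally have "coeff (L * E - L * monom 1 q) D = -1"
    using LE Dq by (simp add: coeff_mult_monom)
  moreover have "coeff A (p * q) = 0" "coeff A 0 = 1"
    using p pq by (auto simp: A_def E_def coeff_ones)
  moreover have "coeff (B * A * L) (p * q)
      = coeff A (p * q) - coeff A 0 + coeff (L * E - L * monom 1 q) D"
    unfolding BAL coeff_add coeff_diff coeff_mult_monom[of _ "q + p - 1"] coeff_mult_monom[of A]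
    using D by (simp flip: D)
  ultimately have "coeff (B * A * L) (p * q) = -2" by simp
  moreover have "q + (q + p - 1) \<le> p * q + 1" using p pq by linarith
  ultimately show ?thesis
    using coeff_monom_sums_mult[of q "q + p - 1" "p * q" G G L] p
    unfolding A B by simp
qed

text \<open>The sum is L_q + 2 L_(q-1) + L_(q-2) = 0 + 2 + 0: modulo \<open>p\<close> the indices
  are 1, 0 and p - 1, and p - 1 > 1.\<close>

lemma double_sum_binary_cyclotomic_cong_1:
  fixes L :: "'a::idom poly"
  assumes L: "L * ones p = pcompose (ones p) (monom 1 q)" and p: "2 < p" "p < q" and q: "q mod p = 1"
  defines "G \<equiv> coeff (ones p * (1 - monom 1 q))"
  shows "(\<Sum>j<2. \<Sum>i\<le>1. G j * G i * coeff L (q - (i + j))) = 2"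
proof -
  have G: "G 0 = 1" "G 1 = 1"
    unfolding G_def using p by (simp_all add: coeff_ones_mult_one_minus_monom)
  have "coeff L q = 0" using coeff_binary_cyclotomic(2)[OF L] p q by simp
  moreover obtain c where c: "q = 1 + p * Suc c"
  proof -
    have "q = 1 + p * (q div p)" using q by (metis mod_mult_div_eq)
    moreover have "q div p \<noteq> 0" using p by (simp add: div_eq_0_iff)
    ultimately show ?thesis using that by (metis not0_implies_Suc)
  qed
  have "coeff L (q - 1) = 1"
    using coeff_binary_cyclotomic(1)[OF L, of "q - 1"] p c by simp
  moreover have "coeff L (q - 2) = 0"
  proof -
    have "q - 2 = (p - 1) + p * c" using p c by simp
    moreover have "((p - 1) + p * c) mod p = p - 1" using p by (simp only: mod_mult_self2) simp
    ultimately have "(q - 2) mod p = p - 1" by simp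
    then show ?thesis using coeff_binary_cyclotomic(1)[OF L, of "q - 2"] p by simp
  qed
  ultimately show ?thesis
    using G by (simp add: lessThan_Suc atMost_Suc numeral_2_eq_2)
qed

section \<open>A coefficient of absolute value 2 in Phi_(p q r s t)\<close>

text \<open>The odd \<open>l\<close> divides x - 1 or x + 1, a positive even number, hence so does 2
  l.\<close>

lemma two_mult_le_of_cong_pm1:
  fixes x l :: nat
  assumes "odd x" and "odd l" and "1 < x" and c: "[int x = 1] (mod int l) \<or> [int x = - 1] (mod int l)"
  shows "2 * l \<le> x + 1"
proof -
  have "l dvd x - 1 \<or> l dvd x + 1"
  proof -
    have "int l dvd int (x - 1) \<or> int l dvd int (x + 1)"
      using c assms(3) by (auto simp: cong_iff_dvd_diff of_nat_diff add.commute)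
    then show ?thesis by (simp only: int_dvd_int_iff)
  qed
  then obtain y where y: "l dvd y" "y = x - 1 \<or> y = x + 1" by blast
  then have "even y" using assms by auto
  then have "2 * l dvd y" using y assms(2) by (intro divides_mult) auto
  then show ?thesis using y assms(3) by (auto dest!: dvd_imp_le)
qed

theorem theorem10p2:
  fixes p q r s t :: nat
  assumes "prime p" and "prime q" and "prime r" and "prime s" and "prime t"
    and "2 < p" and "p < q" and "q < r" and "r < s" and "s < t"
    and "[int t = 1] (mod int (p * q * r * s)) \<or> [int t = - 1] (mod int (p * q * r * s))"
    and "[int s = 1] (mod int (p * q * r)) \<or> [int s = - 1] (mod int (p * q * r))"
    and "[int r = 1] (mod int (p * q)) \<or> [int r = - 1] (mod int (p * q))"
  shows "cyclotomic_height (p * q * r * s * t) > 1"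
proof -
  define L where "L = cyclotomic_poly (p * q)"
  define f where "f = cyclotomic_poly (p * q * r)"
  define a where "a = cyclotomic_poly (p * q * r * s)"
  define h where "h = cyclotomic_poly (p * q * r * s * t)"
  have odd: "odd p" "odd q" "odd r" "odd s" "odd t"
    using assms(1-10) by (simp_all add: prime_odd_nat)
  have cop: "coprime x y" if "prime x" "prime y" "x \<noteq> y" for x y :: nat
    using that by (rule primes_coprime)
  have c: "coprime q p" "coprime r (p * q)" "coprime s (p * q * r)" "coprime t (p * q * r * s)"
    using assms(1-10) by (auto intro!: cop)
  have r: "2 * (p * q) \<le> r + 1"
    using two_mult_le_of_cong_pm1[OF _ _ _ assms(13)] odd assms by simp
  have s: "2 * (p * q * r) \<le> s + 1"
    using two_mult_le_of_cong_pm1[OF _ _ _ assms(12)] odd assms by simp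
  have t: "2 * (p * q * r * s) \<le> t + 1"
    using two_mult_le_of_cong_pm1[OF _ _ _ assms(11)] odd assms by simp
  have pos: "p > 0" "q > 0" "r > 0" "s > 0" "t > 0" using assms by auto
  have nz: "cyclotomic_poly n \<noteq> 0" for n using monic_cyclotomic_poly[of n] by auto
  then have nz': "L \<noteq> 0" "f \<noteq> 0" by (simp_all add: L_def f_def)
  have X: "monom 1 1 - 1 = ([:-1, 1:] :: complex poly)"
    by (simp add: monom_altdef one_pCons)
  \<comment> \<open>The case n = 1 of the composition identity, Phi_p (x - 1) = x^p - 1.\<close>
  have P: "cyclotomic_poly p = ones p" and P1: "ones p * [:-1, 1:] = pcompose [:-1, 1:] (monom 1 p :: complex poly)"
  proof -
    have 1: "cyclotomic_poly p * [:-1, 1:] = pcompose [:-1, 1:] (monom 1 p)"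
      using cyclotomic_poly_pcompose_monom[of 1 p] assms(1) by (simp add: cyclotomic_poly_1[simplified])
    also have "\<dots> = ones p * [:-1, 1:]"
      using ones_mult[of p, where 'a = complex] unfolding X by (simp add: pcompose_pCons one_pCons)
    finally show P: "cyclotomic_poly p = ones p"
      by (metis mult_right_cancel pCons_eq_0_iff zero_neq_one)
    show "ones p * [:-1, 1:] = pcompose [:-1, 1:] (monom 1 p :: complex poly)"
      using 1 by (simp only: P)
  qed
  have Lp: "L * ones p = pcompose (ones p) (monom 1 q)"
    using cyclotomic_poly_pcompose_monom[of p q] pos assms c by (simp add: L_def P)
  have fL: "f * L = pcompose L (monom 1 r)"
    using cyclotomic_poly_pcompose_monom[of "p * q" r] pos assms c by (simp add: L_def f_def)
  have af: "a * f = pcompose f (monom 1 s)"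
    using cyclotomic_poly_pcompose_monom[of "p * q * r" s] pos assms c by (simp add: a_def f_def)
  have ha: "h * a = pcompose a (monom 1 t)"
    using cyclotomic_poly_pcompose_monom[of "p * q * r * s" t] pos assms c by (simp add: a_def h_def)
  have X_refl: "reflect_poly [:-1, 1:] = smult (-1) ([:-1, 1:] :: complex poly)"
    by (simp add: reflect_poly_def)
  have ones_refl: "reflect_poly (ones p :: complex poly) = ones p"
    by (rule reflect_poly_eq_of_pcompose_monom[OF P1 pos(1) _ X_refl]) simp_all
  have L_refl: "reflect_poly L = L"
    by (rule reflect_poly_eq_of_pcompose_monom[OF Lp pos(2), of 1]) (use nz[of p] in \<open>simp_all add: P ones_refl\<close>)
  have f_refl: "reflect_poly f = f"
    by (rule reflect_poly_eq_of_pcompose_monom[OF fL pos(3), of 1]) (simp_all add: L_refl nz')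
  have a_refl: "reflect_poly a = a"
    by (rule reflect_poly_eq_of_pcompose_monom[OF af pos(4), of 1]) (simp_all add: f_refl nz')
  have degs: "degree L = (p - 1) * (q - 1)" "degree f = (p - 1) * (q - 1) * (r - 1)"
    using assms c by (simp_all add: L_def f_def degree_cyclotomic_poly totient_mult_coprime totient_prime
        coprime_commute)
  have pq: "3 * q \<le> p * q" using assms by (intro mult_le_mono) auto
  have rpq: "p * q < r" using r pq pos assms by linarith
  \<comment> \<open>Factor by factor: p - 1 \<ge> 2, q - 1 \<ge> 1, r - 1 \<ge> q. The bound is
    needed for K = q.\<close>
  have "2 * 1 * q \<le> degree f"
    unfolding degs using assms by (intro mult_le_mono) auto
  then have deg_f: "q + 2 \<le> degree f" using assms by linarith
  have rm: "r \<le> p * q * r" using pos by simp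
  define g0 :: "complex poly" where "g0 = ones p * (monom 1 q - 1)"
  define G where "G = coeff (ones p * (1 - monom 1 q) :: complex poly)"
  have g0G: "coeff g0 i = - G i" for i
    by (simp add: g0_def G_def algebra_simps)
  have L0: "coeff L 0 = 1" using coeff_binary_cyclotomic(1)[OF Lp, of 0] assms by simp
  have G0: "G 0 = 1" using coeff_ones_mult_one_minus_monom[of p q 0] assms by (simp add: G_def)
  have Lg0: "L * g0 = monom 1 (p * q) - 1"
    using binary_cyclotomic_cofactor[OF Lp pos(2)] by (simp add: g0_def)
  have deg_g0: "degree g0 < p * q"
    using degree_cofactor_less[OF Lg0] pos assms degs by simp
  \<comment> \<open>\<open>g\<close> is Psi_(p q r); \<open>g0\<close>, which is Psi_(p q), has
    constant term -1, whence the sign.\<close>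
  obtain g where fg: "f * g = monom 1 (p * q * r) - 1"
    and g: "\<And>j. j < r \<Longrightarrow> coeff g j = - coeff L j"
    using ex_cofactor_pcompose_monom[OF Lg0 fL pos(3)] by (auto simp: g0G G0)
  \<comment> \<open>For k < p q < r only the term i = 0 of the expansion remains, namely - L_0 times
    the coefficient of \<open>g0\<close>.\<close>
  have f: "coeff f k = G k" if "k < p * q" for k
    using coeff_kaplan[OF Lg0 deg_g0 fL _ pos(3), of k] that rpq nz'
    by (simp add: L0 g0G)
  have g_0: "coeff g 0 = -1" using g[of 0] pos L0 by simp
  \<comment> \<open>The bounds on \<open>K\<close>, \<open>v\<close> and \<open>U\<close> keep every
    index in the ranges where \<open>f\<close> agrees with \<open>G\<close> and \<open>g\<close>
    with \<open>- L\<close>.\<close>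
  have main: "\<exists>k. cmod (coeff h k) = 2"
    if K: "0 < K" "K < p * q" "K + 2 \<le> degree f" and v: "0 < v" "v \<le> p * q" "K + v \<le> U + 1"
      and U: "U \<le> p * q" and S: "cmod (\<Sum>j<v. \<Sum>i\<le>K. G j * G i * coeff L (U - (i + j))) = 2" for K v U
  proof -
    have Um: "U < p * q * r" using U rpq rm by linarith
    obtain k \<epsilon> where k: "\<epsilon> \<in> {1, -1}" "coeff h k = \<epsilon> *
        (\<Sum>j<v. \<Sum>i\<le>K. coeff f j * coeff f i * coeff g (U - (i + j)))"
      using coeff_two_blocks[OF fg f_refl g_0 af a_refl ha assms(12) s assms(11) _ K(1,3) v(1,3) Um] t pos
      by fastforce
    have "(\<Sum>j<v. \<Sum>i\<le>K. coeff f j * coeff f i * coeff g (U - (i + j)))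
        = (\<Sum>j<v. \<Sum>i\<le>K. - (G j * G i * coeff L (U - (i + j))))"
      using K v U rpq by (intro sum.cong refl) (simp add: f g)
    also have "\<dots> = - (\<Sum>j<v. \<Sum>i\<le>K. G j * G i * coeff L (U - (i + j)))"
      by (simp only: sum_negf)
    finally have "cmod (coeff h k) = 2" using S k by (auto simp: norm_mult)
    then show ?thesis ..
  qed
  have "\<exists>k. cmod (coeff h k) = 2"
  proof (cases "q mod p = 1")
    case True
    have "1 < p * q" "2 \<le> p * q" using pq assms(6,7) by linarith+
    then show ?thesis
      using assms(6,7) deg_f double_sum_binary_cyclotomic_cong_1[OF Lp _ _ True]
      by (intro main[of 1 2 q]) (simp_all add: G_def[symmetric])
  next
    case False
    have "\<not> p dvd q" using assms by (auto simp: prime_nat_iff)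
    moreover have "q + p - 1 \<le> p * q" "q + (q + p - 1) \<le> p * q + 1"
      using pq assms(6,7) by linarith+
    ultimately show ?thesis
      using assms(6,7) deg_f double_sum_binary_cyclotomic[OF Lp _ _ _ degs(1) L_refl False]
      by (intro main[of q "q + p - 1" "p * q"]) (simp_all add: G_def[symmetric])
  qed
  then obtain k where k: "cmod (coeff h k) = 2" by blast
  then have "k \<le> degree h" by (intro le_degree) auto
  then have "cmod (coeff h k) \<le> cyclotomic_height (p * q * r * s * t)"
    unfolding cyclotomic_height_def h_def by (intro Max_ge) auto
  then show ?thesis using k by simp
qed

end
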